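(* Let $G$ be a finitely generated profinite group. Then an element $g \in G$ is a test element of $G$ if and only if $g$ is not contained in any proper retract of $G$.
   Context: Subgroups of profinite groups are closed, generation is topological, and homomorphisms between profinite groups are continuous. An element $g$ of a profinite group $G$ is a test element of $G$ if every (continuous) endomorphism $\varphi: G\to G$ with $\varphi(g)=g$ is an automorphism. A retract of $G$ is a subgroup $H\le G$ for which there is a (continuous) epimorphism $r:G\to H$ restricting to the identity on $H$; it is proper if $H\neq G$. *)

theory Defs
  imports "HOL-Analysis.Abstract_Topological_Spaces" "HOL-Algebra.Generated_Groups"
begin

locale topological_group = group G for G (structure) and T :: "'a topology" +
  assumes topspace_eq_carrier: "topspace T = carrier G"
    and continuous_mult: "continuous_map (prod_topology T T) T (\<lambda>(x, y). x \<otimes> y)"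
    and continuous_inv: "continuous_map T T (\<lambda>x. inv x)"

definition totally_disconnected_space :: "'a topology \<Rightarrow> bool"
  where "totally_disconnected_space T \<longleftrightarrow> (\<forall>S. connectedin T S \<longrightarrow> (\<exists>a. S \<subseteq> {a}))"

locale profinite_group = topological_group +
  assumes compact: "compact_space T"
    and Hausdorff: "Hausdorff_space T"
    and totally_disconnected: "totally_disconnected_space T"

definition topologically_finitely_generated ::
    "('a, 'b) monoid_scheme \<Rightarrow> 'a topology \<Rightarrow> bool"
  where "topologically_finitely_generated G T \<longleftrightarrow>
    (\<exists>S \<subseteq> carrier G. finite S \<and> T closure_of (generate G S) = carrier G)"

definition closed_subgroup :: "'a set \<Rightarrow> ('a, 'b) monoid_scheme \<Rightarrow> 'a topology \<Rightarrow> bool"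
  where "closed_subgroup H G T \<longleftrightarrow> subgroup H G \<and> closedin T H"

definition continuous_endomorphism ::
    "('a, 'b) monoid_scheme \<Rightarrow> 'a topology \<Rightarrow> ('a \<Rightarrow> 'a) \<Rightarrow> bool"
  where "continuous_endomorphism G T \<phi> \<longleftrightarrow> \<phi> \<in> hom G G \<and> continuous_map T T \<phi>"

text \<open>An automorphism is taken in the category of topological groups.\<close>

definition continuous_automorphism ::
    "('a, 'b) monoid_scheme \<Rightarrow> 'a topology \<Rightarrow> ('a \<Rightarrow> 'a) \<Rightarrow> bool"
  where "continuous_automorphism G T \<phi> \<longleftrightarrow> \<phi> \<in> iso G G \<and> homeomorphic_map T T \<phi>"

definition test_element :: "('a, 'b) monoid_scheme \<Rightarrow> 'a topology \<Rightarrow> 'a \<Rightarrow> bool"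
  where "test_element G T g \<longleftrightarrow> g \<in> carrier G \<and>
    (\<forall>\<phi>. continuous_endomorphism G T \<phi> \<and> \<phi> g = g \<longrightarrow> continuous_automorphism G T \<phi>)"

definition retract_of_group :: "'a set \<Rightarrow> ('a, 'b) monoid_scheme \<Rightarrow> 'a topology \<Rightarrow> bool"
  where "retract_of_group H G T \<longleftrightarrow> closed_subgroup H G T \<and>
    (\<exists>r \<in> epi G (G\<lparr>carrier := H\<rparr>).
       continuous_map T (subtopology T H) r \<and> (\<forall>h \<in> H. r h = h))"

definition proper_retract_of_group ::
    "'a set \<Rightarrow> ('a, 'b) monoid_scheme \<Rightarrow> 'a topology \<Rightarrow> bool"
  where "proper_retract_of_group H G T \<longleftrightarrow> retract_of_group H G T \<and> H \<noteq> carrier G"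

end

theory Submission
  imports Defs
begin

text \<open>A retraction onto a proper retract containing \<open>g\<close> is an endomorphism that fixes \<open>g\<close> and is not
  surjective. Conversely, let \<open>\<phi>\<close> fix \<open>g\<close>. For an open subgroup \<open>U\<close>, the map
  \<open>x \<mapsto> U \<phi>\<^sup>n(x)\<close> into the finite set of cosets is determined by \<open>U\<close> and by its transition table
  on topological generators of \<open>G\<close>, so only finitely many maps arise as \<open>n\<close> varies and
  the sequence of these maps is eventually periodic. Hence \<open>\<phi>\<^bsup>n!\<^esup>\<close> is eventually constant and
  idempotent modulo \<open>U\<close>, and since open subgroups form a neighbourhood base at the identity, it
  converges to a continuous idempotent endomorphism \<open>r\<close>. Its image is a retract containing \<open>g\<close>.
  If that image is all of \<open>G\<close>, then \<open>r\<close> is the identity, which forces \<open>\<phi>\<close> to be bijective.\<close>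

section \<open>Quasi-components and clopen neighbourhoods in compact spaces\<close>

text \<open>A point outside the quasi-component lies in a clopen set that misses \<open>x\<close>.
  So \<open>W\<close> and these clopen sets cover the space, and the complement of the union of a
  finite subfamily of them is clopen.\<close>

lemma clopen_neighbourhood_of_quasi_component:
  assumes "compact_space X" "x \<in> topspace X" "openin X W" "quasi_component_of_set X x \<subseteq> W"
  obtains K where "openin X K" "closedin X K" "x \<in> K" "K \<subseteq> W"
proof -
  define \<C> where "\<C> = {C. openin X C \<and> closedin X C \<and> x \<notin> C}"
  have "topspace X \<subseteq> \<Union>(insert W \<C>)"
  proof
    fix y assume y: "y \<in> topspace X"
    show "y \<in> \<Union>(insert W \<C>)"
    proof (cases "quasi_component_of X x y")
      case True
      then show ?thesis using assms(4) by auto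
    next
      case False
      then obtain K where "x \<in> K" "closedin X K" "openin X K" "y \<notin> K"
        using assms(2) y unfolding quasi_component_of by blast
      then have "topspace X - K \<in> \<C>" "y \<in> topspace X - K"
        using y by (auto simp: \<C>_def)
      then show ?thesis by blast
    qed
  qed
  moreover have "\<forall>V \<in> insert W \<C>. openin X V"
    using assms(3) by (auto simp: \<C>_def)
  ultimately obtain \<F> where \<F>: "finite \<F>" "\<F> \<subseteq> insert W \<C>" "topspace X \<subseteq> \<Union>\<F>"
    using assms(1) unfolding compact_space_alt by metis
  define K where "K = topspace X - \<Union>(\<F> - {W})"
  have sub: "\<F> - {W} \<subseteq> \<C>"
    using \<F>(2) by blast
  have "openin X (\<Union>(\<F> - {W}))" "closedin X (\<Union>(\<F> - {W}))"
    using sub \<F>(1) by (auto simp: \<C>_def intro!: closedin_Union)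
  then have "openin X K" "closedin X K"
    by (auto simp: K_def)
  moreover have "x \<in> K" "K \<subseteq> W"
    using assms(2) sub \<F>(3) by (auto simp: K_def \<C>_def)
  ultimately show thesis
    using that by blast
qed

text \<open>Suppose the quasi-component \<open>Q\<close> splits into disjoint closed parts
  \<open>A\<close> and \<open>B\<close> with \<open>x\<close> in \<open>A\<close>. Normality
  separates them by disjoint open \<open>V\<close> and \<open>W\<close>, and some clopen
  \<open>K\<close> around \<open>x\<close> lies inside their union. Then the part of
  \<open>K\<close> in \<open>V\<close> is clopen, hence contains \<open>Q\<close>, and
  \<open>B\<close> is empty.\<close>

lemma connectedin_quasi_component_of:
  assumes "compact_space X" "Hausdorff_space X"
  shows "connectedin X (quasi_component_of_set X x)"
proof (cases "x \<in> topspace X")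
  case False
  then have "quasi_component_of_set X x = {}"
    by (rule iffD2[OF quasi_component_of_eq_empty])
  then show ?thesis
    by (metis connectedin_empty)
next
  case x: True
  define Q where "Q = quasi_component_of_set X x"
  have xQ: "x \<in> Q" and QX: "Q \<subseteq> topspace X" and cl: "closedin X Q"
    unfolding Q_def
    using x closedin_quasi_component_of[of X x] quasi_component_of_subset_topspace[of X x] by simp_all
  have key: "B = {}"
    if A: "closedin X A" and B: "closedin X B" and Q: "Q = A \<union> B" and AB: "A \<inter> B = {}" and xA: "x \<in> A"
    for A B
  proof -
    have "normal_space X"
      using assms compact_Hausdorff_or_regular_imp_normal_space by blast
    then obtain V W where VW: "openin X V" "openin X W" "A \<subseteq> V" "B \<subseteq> W" "disjnt V W"
      using A B AB unfolding normal_space_def disjnt_def by metis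
    have "quasi_component_of_set X x \<subseteq> V \<union> W"
      using Q VW by (auto simp: Q_def)
    then obtain K where K: "openin X K" "closedin X K" "x \<in> K" "K \<subseteq> V \<union> W"
      using clopen_neighbourhood_of_quasi_component[OF assms(1) x openin_Un[OF VW(1,2)]] by metis
    \<comment> \<open>The left side is visibly open, the right side visibly closed.\<close>
    have eq: "K \<inter> V = K - W"
      using K VW by (auto simp: disjnt_def)
    have "openin X (K \<inter> V)" "closedin X (K \<inter> V)"
      using K VW by (auto simp: eq closedin_diff) (simp add: eq[symmetric] openin_Int)
    moreover have "x \<in> K \<inter> V"
      using K VW xA by blast
    ultimately have "y \<in> K \<inter> V" if "quasi_component_of X x y" for y
      using that by (meson quasi_component_of)
    then have "Q \<subseteq> K \<inter> V"
      by (auto simp only: Q_def)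
    then show "B = {}"
      using VW Q by (auto simp: disjnt_def)
  qed
  have "connectedin X Q"
    unfolding connectedin_closedin
  proof (intro conjI QX notI)
    assume "\<exists>E1 E2. closedin X E1 \<and> closedin X E2 \<and> Q \<subseteq> E1 \<union> E2 \<and>
      E1 \<inter> E2 \<inter> Q = {} \<and> E1 \<inter> Q \<noteq> {} \<and> E2 \<inter> Q \<noteq> {}"
    then obtain A B where AB: "closedin X A" "closedin X B" "Q \<subseteq> A \<union> B"
      "A \<inter> B \<inter> Q = {}" "A \<inter> Q \<noteq> {}" "B \<inter> Q \<noteq> {}"
      by metis
    have c: "closedin X (A \<inter> Q)" "closedin X (B \<inter> Q)"
      using AB cl by blast+
    show False
    proof (cases "x \<in> A")
      case True
      show False
        using key[OF c] True xQ AB by blast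
    next
      case False
      show False
        using key[OF c(2,1)] False xQ AB by blast
    qed
  qed
  then show ?thesis by (simp add: Q_def)
qed

text \<open>Being connected, the quasi-component of \<open>x\<close> is just the point
  \<open>x\<close>, so it lies in every neighbourhood of \<open>x\<close>.\<close>

lemma clopen_neighbourhood_base:
  assumes "compact_space X" "Hausdorff_space X" "totally_disconnected_space X"
    and "openin X W" "x \<in> W"
  obtains K where "openin X K" "closedin X K" "x \<in> K" "K \<subseteq> W"
proof -
  have x: "x \<in> topspace X"
    using assms(4,5) openin_subset by blast
  obtain a where "quasi_component_of_set X x \<subseteq> {a}"
    using assms(3) connectedin_quasi_component_of[OF assms(1,2)]
    unfolding totally_disconnected_space_def by blast
  moreover have "x \<in> quasi_component_of_set X x"
    using x by simp
  ultimately have "quasi_component_of_set X x \<subseteq> W"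
    using assms(5) by blast
  then show thesis
    using clopen_neighbourhood_of_quasi_component[OF assms(1) x assms(4)] that by blast
qed

section \<open>Cosets, continuity and limits in topological groups\<close>

lemma (in group) rcos_eq_iff:
  assumes "subgroup U G" "x \<in> carrier G" "y \<in> carrier G"
  shows "U #> x = U #> y \<longleftrightarrow> x \<in> U #> y"
  using assms by (metis rcos_self repr_independence)

lemma (in group) rcos_eq_mult_right:
  assumes "subgroup U G" "x \<in> carrier G" "y \<in> carrier G" "z \<in> carrier G" "U #> x = U #> y"
  shows "U #> (x \<otimes> z) = U #> (y \<otimes> z)"
  using assms by (metis coset_mult_assoc subgroup.subset)

context topological_group
begin

lemma continuous_map_mult [continuous_intros]:
  assumes "continuous_map X T f" "continuous_map X T h"
  shows "continuous_map X T (\<lambda>x. f x \<otimes> h x)"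
proof -
  have "continuous_map X (prod_topology T T) (\<lambda>x. (f x, h x))"
    using assms by (simp add: continuous_map_pairwise o_def)
  from continuous_map_compose[OF this continuous_mult] show ?thesis
    by (simp add: o_def)
qed

lemma limitin_mult:
  assumes "limitin T f a F" "limitin T h b F"
  shows "limitin T (\<lambda>n. f n \<otimes> h n) (a \<otimes> b) F"
proof -
  have "limitin (prod_topology T T) (\<lambda>n. (f n, h n)) (a, b) F"
    using assms by (simp add: limitin_pairwise o_def)
  from continuous_map_limit[OF continuous_mult this] show ?thesis
    by (simp add: o_def)
qed

lemma continuous_map_mult_right:
  "a \<in> carrier G \<Longrightarrow> continuous_map T T (\<lambda>x. x \<otimes> a)"
  by (intro continuous_map_mult) (simp_all add: topspace_eq_carrier)

lemma r_coset_eq_vimage: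
  assumes "V \<subseteq> carrier G" "x \<in> carrier G"
  shows "V #> x = {y \<in> topspace T. y \<otimes> inv x \<in> V}"
proof -
  have "y \<in> V #> x" if "y \<in> carrier G" "y \<otimes> inv x \<in> V" for y
  proof -
    have "y \<otimes> inv x \<otimes> x = y"
      using that assms by (simp add: m_assoc)
    then show ?thesis
      using that by (metis rcosI assms)
  qed
  moreover have "y \<in> carrier G \<and> y \<otimes> inv x \<in> V" if "y \<in> V #> x" for y
  proof -
    obtain v where "v \<in> V" "y = v \<otimes> x"
      using \<open>y \<in> V #> x\<close> unfolding r_coset_def by blast
    then show ?thesis
      using assms by (auto simp: m_assoc subset_iff)
  qed
  ultimately show ?thesis
    unfolding topspace_eq_carrier by blast
qed

lemma openin_r_coset:
  assumes "openin T V" "x \<in> carrier G"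
  shows "openin T (V #> x)"
  using openin_continuous_map_preimage[OF continuous_map_mult_right[of "inv x"] assms(1)]
    openin_subset[OF assms(1)] assms(2)
  by (simp add: r_coset_eq_vimage topspace_eq_carrier)

lemma closedin_r_coset:
  assumes "closedin T V" "x \<in> carrier G"
  shows "closedin T (V #> x)"
  using closedin_continuous_map_preimage[OF continuous_map_mult_right[of "inv x"] assms(1)]
    closedin_subset[OF assms(1)] assms(2)
  by (simp add: r_coset_eq_vimage topspace_eq_carrier)

lemma openin_rcos_eq:
  assumes "subgroup U G" "openin T U" "continuous_map T T f" "y \<in> carrier G"
  shows "openin T {x \<in> carrier G. U #> f x = U #> y}"
proof -
  have "f x \<in> carrier G" if "x \<in> carrier G" for x
    using that assms(3) topspace_eq_carrier continuous_map_image_subset_topspace by blast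
  then have "{x \<in> carrier G. U #> f x = U #> y} = {x \<in> topspace T. f x \<in> U #> y}"
    using rcos_eq_iff[OF assms(1) _ assms(4)] unfolding topspace_eq_carrier by blast
  then show ?thesis
    using openin_continuous_map_preimage[OF assms(3) openin_r_coset[OF assms(2,4)]] by simp
qed

text \<open>The complement is a union of cosets, each of them open.\<close>

lemma closedin_open_subgroup:
  assumes "subgroup U G" "openin T U"
  shows "closedin T U"
proof -
  have sub: "U \<subseteq> carrier G" using assms(1) subgroup.subset by blast
  have "carrier G - U = \<Union>((\<lambda>x. U #> x) ` (carrier G - U))"
  proof (intro equalityI subsetI)
    fix y assume "y \<in> carrier G - U"
    then show "y \<in> \<Union>((\<lambda>x. U #> x) ` (carrier G - U))"
      using rcos_self assms(1) by blast
  next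
    fix y assume "y \<in> \<Union>((\<lambda>x. U #> x) ` (carrier G - U))"
    then obtain x where x: "x \<in> carrier G" "x \<notin> U" "y \<in> U #> x" by blast
    then have y: "y \<in> carrier G" using sub r_coset_subset_G by blast
    moreover have "y \<notin> U"
    proof
      assume "y \<in> U"
      then have "U #> x = U"
        using repr_independence[OF x(3,1) assms(1)] coset_join2[OF y assms(1)] by simp
      then show False using x rcos_self assms(1) by blast
    qed
    ultimately show "y \<in> carrier G - U" by blast
  qed
  moreover have "openin T (\<Union>((\<lambda>x. U #> x) ` (carrier G - U)))"
    using openin_r_coset assms(2) by blast
  ultimately show ?thesis
    using sub by (simp add: closedin_def topspace_eq_carrier)
qed

lemma continuous_endomorphism_funpow:
  assumes "continuous_endomorphism G T \<phi>"
  shows "continuous_endomorphism G T (\<phi> ^^ n)"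
proof (induction n)
  case 0
  then show ?case
    by (auto simp: continuous_endomorphism_def hom_def)
next
  case (Suc n)
  then show ?case
    using assms by (auto simp: continuous_endomorphism_def o_def hom_def Pi_iff
        intro: continuous_map_compose[unfolded o_def])
qed

end

section \<open>Open subgroups of a profinite group\<close>

context profinite_group
begin

text \<open>Take a clopen neighbourhood \<open>K\<close> of the identity inside \<open>W\<close>.
  The elements \<open>x\<close> with \<open>K #> x = K\<close> form a subgroup, which lies in
  \<open>K\<close> because \<open>K\<close> contains the identity; compactness makes this condition
  on \<open>x\<close> open.\<close>

lemma exists_open_subgroup:
  assumes "openin T W" "\<one> \<in> W"
  obtains U where "subgroup U G" "openin T U" "U \<subseteq> W"
proof -
  obtain K where K: "openin T K" "closedin T K" "\<one> \<in> K" "K \<subseteq> W"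
    using clopen_neighbourhood_base[OF compact Hausdorff totally_disconnected assms] .
  have KG: "K \<subseteq> carrier G"
    using K openin_subset topspace_eq_carrier by blast
  define V where "V = {x \<in> carrier G. \<forall>k \<in> K. k \<otimes> x \<in> K}"
  define U where "U = {x \<in> V. inv x \<in> V}"
  \<comment> \<open>The bad pairs: \<open>k\<close> in \<open>K\<close> with
    \<open>k \<otimes> x\<close> outside \<open>K\<close>. They form a closed, hence compact set, so
    its projection to the second factor is closed; that projection is the complement of
    \<open>V\<close>.\<close>
  define B where "B = {z \<in> topspace (prod_topology T T). (case z of (k, x) \<Rightarrow> k \<otimes> x) \<in> topspace T - K}
      \<inter> (K \<times> topspace T)"
  have "closedin T (topspace T - K)"
    using K by blast
  from closedin_continuous_map_preimage[OF continuous_mult this]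
  have "closedin (prod_topology T T) B"
    unfolding B_def using K by (intro closedin_Int) (simp_all only: closedin_prod_Times_iff closedin_topspace simp_thms)
  then have "compactin (prod_topology T T) B"
    using compact closedin_compact_space compact_space_prod_topology by blast
  then have "compactin T (snd ` B)"
    using image_compactin continuous_map_snd by blast
  then have "closedin T (snd ` B)"
    using Hausdorff compactin_imp_closedin by blast
  moreover have "V = topspace T - snd ` B"
  proof (intro equalityI subsetI)
    fix x assume "x \<in> V"
    then show "x \<in> topspace T - snd ` B"
      by (auto simp: V_def B_def topspace_eq_carrier)
  next
    fix x assume x: "x \<in> topspace T - snd ` B"
    have "k \<otimes> x \<in> K" if "k \<in> K" for k
    proof (rule ccontr)
      assume "k \<otimes> x \<notin> K"
      then have "(k, x) \<in> B"
        using that x KG by (auto simp: B_def topspace_eq_carrier)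
      then show False
        using x by force
    qed
    then show "x \<in> V"
      using x by (simp add: V_def topspace_eq_carrier)
  qed
  ultimately have openV: "openin T V"
    by blast
  have "U = V \<inter> {x \<in> topspace T. inv x \<in> V}"
    by (auto simp: U_def V_def topspace_eq_carrier)
  then have openU: "openin T U"
    using openV openin_continuous_map_preimage[OF continuous_inv openV] by auto
  have Vmult: "x \<otimes> y \<in> V" if "x \<in> V" "y \<in> V" for x y
    using that KG by (auto simp: V_def m_assoc[symmetric] subset_iff)
  have "subgroup U G"
  proof (rule subgroupI)
    show "U \<subseteq> carrier G" by (auto simp: U_def V_def)
    have "\<one> \<in> U" using KG by (auto simp: U_def V_def subset_iff)
    then show "U \<noteq> {}" by blast
    show "inv a \<in> U" if "a \<in> U" for a
      using that by (auto simp: U_def V_def)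
    show "a \<otimes> b \<in> U" if "a \<in> U" "b \<in> U" for a b
    proof -
      have "inv (a \<otimes> b) = inv b \<otimes> inv a"
        using that by (auto simp: U_def V_def inv_mult_group)
      then show ?thesis
        using that Vmult by (auto simp: U_def)
    qed
  qed
  moreover have "V \<subseteq> K"
    using K(3) unfolding V_def by force
  then have "U \<subseteq> W"
    using K(4) by (auto simp: U_def)
  ultimately show thesis
    using that openU by blast
qed

lemma exists_open_subgroup_coset:
  assumes "openin T W" "x \<in> W"
  obtains U where "subgroup U G" "openin T U" "U #> x \<subseteq> W"
proof -
  have W: "W \<subseteq> carrier G" and x: "x \<in> carrier G"
    using assms openin_subset topspace_eq_carrier by blast+
  have "\<one> \<in> W #> inv x"
    using rcosI[OF assms(2) W, of "inv x"] x by simp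
  then obtain U where U: "subgroup U G" "openin T U" "U \<subseteq> W #> inv x"
    using exists_open_subgroup openin_r_coset assms(1) x by (metis inv_closed)
  have "U #> x \<subseteq> (W #> inv x) #> x"
    using U(3) by (auto simp: r_coset_def)
  also have "\<dots> = W"
    using W x by (simp add: coset_mult_assoc)
  finally show thesis
    using that U by blast
qed

text \<open>Cosets are open and pairwise disjoint, so a finite subcover must already contain all of
  them.\<close>

lemma finite_rcosets_open_subgroup:
  assumes "subgroup U G" "openin T U"
  shows "finite (rcosets U)"
proof -
  have "\<forall>C \<in> rcosets U. openin T C"
    using openin_r_coset assms by (auto simp: RCOSETS_def)
  moreover have cover: "\<Union>(rcosets U) = carrier G"
    using rcosets_part_G assms(1) .
  ultimately obtain \<F> where \<F>: "finite \<F>" "\<F> \<subseteq> rcosets U" "carrier G \<subseteq> \<Union>\<F>"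
    using compact topspace_eq_carrier unfolding compact_space_alt by (metis subset_refl)
  have "rcosets U \<subseteq> \<F>"
  proof
    fix C assume "C \<in> rcosets U"
    then obtain x where x: "x \<in> carrier G" "C = U #> x"
      by (auto simp: RCOSETS_def)
    then obtain D where D: "D \<in> \<F>" "x \<in> D" using \<F>(3) by blast
    then obtain y where y: "y \<in> carrier G" "D = U #> y"
      using \<F>(2) by (auto simp: RCOSETS_def)
    have "C = D"
      using x y D rcos_eq_iff assms(1) by blast
    then show "C \<in> \<F>" using D by simp
  qed
  then show ?thesis using \<F>(1) finite_subset by blast
qed

text \<open>Cosets of open subgroups form a neighbourhood base at each point. This turns convergence
  into eventual equality of cosets, the form in which periodicity modulo \<open>U\<close> can be
  used.\<close>

lemma limitin_iff_rcos:
  assumes "l \<in> carrier G" "\<And>n. f n \<in> carrier G"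
  shows "limitin T f l F \<longleftrightarrow>
    (\<forall>U. subgroup U G \<and> openin T U \<longrightarrow> (\<forall>\<^sub>F n in F. U #> f n = U #> l))"
proof (intro iffI allI impI)
  fix U assume lim: "limitin T f l F" and U: "subgroup U G \<and> openin T U"
  then have "\<forall>\<^sub>F n in F. f n \<in> U #> l"
    using assms(1) openin_r_coset rcos_self by (simp add: limitin_def)
  then show "\<forall>\<^sub>F n in F. U #> f n = U #> l"
    by (rule eventually_mono) (use U assms rcos_eq_iff in blast)
next
  assume *: "\<forall>U. subgroup U G \<and> openin T U \<longrightarrow> (\<forall>\<^sub>F n in F. U #> f n = U #> l)"
  show "limitin T f l F"
    unfolding limitin_def topspace_eq_carrier
  proof (intro conjI allI impI)
    fix W assume "openin T W \<and> l \<in> W"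
    then obtain U where U: "subgroup U G" "openin T U" "U #> l \<subseteq> W"
      using exists_open_subgroup_coset by blast
    then have "\<forall>\<^sub>F n in F. U #> f n = U #> l" using * by blast
    then show "\<forall>\<^sub>F n in F. f n \<in> W"
      by (rule eventually_mono) (use U assms rcos_eq_iff in blast)
  qed (fact assms(1))
qed

section \<open>Iterates of an endomorphism modulo an open subgroup\<close>

text \<open>Since \<open>U\<close> is not assumed to be \<open>\<phi>\<close>-invariant,
  \<open>\<phi>\<close> need not induce a map on cosets. The pigeonhole principle is therefore
  applied to the maps sending \<open>x\<close> to the coset of \<open>(\<phi> ^^ n) x\<close>, each
  encoded by a finite table. The threshold and the period are uniform in \<open>x\<close>.\<close>

lemma eventually_periodic_rcos:
  assumes fg: "topologically_finitely_generated G T"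
    and \<phi>: "continuous_endomorphism G T \<phi>"
    and U: "subgroup U G" "openin T U"
  shows "\<exists>p>0. \<exists>a. \<forall>n\<ge>a. \<forall>x \<in> carrier G. U #> (\<phi> ^^ (n + p)) x = U #> (\<phi> ^^ n) x"
proof -
  obtain S where S: "S \<subseteq> carrier G" "finite S" "T closure_of (generate G S) = carrier G"
    using fg unfolding topologically_finitely_generated_def by blast
  define f where "f n x = U #> (\<phi> ^^ n) x" for n x
  have cont: "continuous_map T T (\<phi> ^^ n)" and hom: "\<phi> ^^ n \<in> hom G G" for n
    using continuous_endomorphism_funpow[OF \<phi>] by (auto simp: continuous_endomorphism_def)
  have clos: "(\<phi> ^^ n) x \<in> carrier G" if "x \<in> carrier G" for n x
    using hom that by (meson hom_in_carrier)
  \<comment> \<open>Right multiplication is well defined on the states, so the automaton below is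
    deterministic.\<close>
  have f_mult: "f n (x \<otimes> z) = f n (y \<otimes> z)"
    if "f n x = f n y" "x \<in> carrier G" "y \<in> carrier G" "z \<in> carrier G" for n x y z
    using that clos U(1) hom_mult[OF hom] rcos_eq_mult_right by (simp add: f_def)
  \<comment> \<open>Inverses are letters too, so that words reach all of
    \<open>generate G S\<close>.\<close>
  define S' where "S' = S \<union> m_inv G ` S"
  have S': "S' \<subseteq> carrier G"
    using S by (auto simp: S'_def)
  \<comment> \<open>The transition table of the finite automaton that reads words in \<open>S'\<close>, with the cosets
    \<open>f n x\<close> as states.\<close>
  define R where "R n = {(s, A, B). s \<in> S' \<and> (\<exists>x \<in> carrier G. A = f n x \<and> B = f n (x \<otimes> s))}" for n
  have "R n \<subseteq> S' \<times> (rcosets U) \<times> (rcosets U)" for n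
    using clos U(1) S' by (auto simp: R_def f_def intro!: rcosetsI subgroup.subset)
  then have "range R \<subseteq> Pow (S' \<times> (rcosets U) \<times> (rcosets U))"
    by blast
  moreover have "finite (S' \<times> (rcosets U) \<times> (rcosets U))"
    using S finite_rcosets_open_subgroup U by (simp add: S'_def)
  ultimately have "finite (range R)"
    by (meson finite_Pow_iff finite_subset)
  then have "\<not> inj R"
    using finite_imageD infinite_UNIV_nat by blast
  then obtain a b where ab: "a < b" "R a = R b"
    unfolding inj_def by (metis linorder_neqE_nat)
  have step: "f a (x \<otimes> s) = f b (y \<otimes> s)"
    if "s \<in> S'" "f a x = f b y" "x \<in> carrier G" "y \<in> carrier G" for s x y
  proof -
    \<comment> \<open>The shared table entry only provides some representative \<open>z\<close> of
      the state in the automaton for \<open>b\<close>; determinism replaces it by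
      \<open>y\<close>.\<close>
    have "(s, f a x, f a (x \<otimes> s)) \<in> R b"
      using that unfolding ab(2)[symmetric] by (auto simp: R_def)
    then obtain z where z: "z \<in> carrier G" "f a x = f b z" "f a (x \<otimes> s) = f b (z \<otimes> s)"
      by (auto simp: R_def)
    then show ?thesis
      using f_mult[of b z y s] that S' by auto
  qed
  have words: "f a (x \<otimes> d) = f b (y \<otimes> d)"
    if "d \<in> generate G S" "f a x = f b y" "x \<in> carrier G" "y \<in> carrier G" for d x y
    using that
  proof (induction arbitrary: x y)
    case one
    then show ?case by simp
  next
    case (incl h)
    then show ?case by (intro step) (auto simp: S'_def)
  next
    case (inv h)
    then show ?case by (intro step) (auto simp: S'_def)
  next
    case (eng h1 h2)
    have "h1 \<in> carrier G" "h2 \<in> carrier G"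
      using eng.hyps S(1) generate_in_carrier by blast+
    then show ?case
      using eng.IH(2)[OF eng.IH(1)[OF eng.prems]] eng.prems by (simp add: m_assoc)
  qed
  \<comment> \<open>Both automata start in the same state, the coset of the identity.\<close>
  have dense: "f a d = f b d" if "d \<in> generate G S" for d
  proof -
    have "(\<phi> ^^ n) \<one> = \<one>" for n
      using hom_one[OF hom] by (simp add: group_axioms)
    then have "f a \<one> = f b \<one>" by (simp add: f_def)
    moreover have "d \<in> carrier G"
      using that S(1) generate_in_carrier by blast
    ultimately show ?thesis
      using words[OF that, of \<one> \<one>] by simp
  qed
  have eq: "f a x = f b x" if x: "x \<in> carrier G" for x
  proof -
    \<comment> \<open>Both coset maps are locally constant, so their agreement passes from the dense
      subgroup to \<open>x\<close>.\<close>
    define W where "W = {y \<in> carrier G. f a y = f a x} \<inter> {y \<in> carrier G. f b y = f b x}"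
    have "openin T W"
      unfolding W_def f_def using openin_rcos_eq[OF U cont clos[OF x]] by blast
    moreover have "x \<in> W" using x by (simp add: W_def)
    moreover have "x \<in> T closure_of (generate G S)" using x S by simp
    ultimately obtain d where d: "d \<in> generate G S" "d \<in> W"
      unfolding in_closure_of by blast
    then have "f a x = f a d" "f b d = f b x" by (simp_all add: W_def)
    then show ?thesis using dense[OF d(1)] by simp
  qed
  show ?thesis
  proof (intro exI conjI allI impI ballI)
    \<comment> \<open>The period is \<open>b - a\<close>: the agreement of the \<open>a\<close>-th
      and \<open>b\<close>-th iterates modulo \<open>U\<close> is applied at the point
      \<open>(\<phi> ^^ (n - a)) x\<close>.\<close>
    show "b - a > 0" using ab by simp
    fix n x assume n: "n \<ge> a" and x: "x \<in> carrier G"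
    have "n + (b - a) = b + (n - a)" "n = a + (n - a)"
      using n ab by auto
    then show "U #> (\<phi> ^^ (n + (b - a))) x = U #> (\<phi> ^^ n) x"
      using eq[OF clos[OF x, of "n - a"]] by (metis f_def comp_apply funpow_add)
  qed
qed

text \<open>Once \<open>n\<close> is at least both \<open>a\<close> and \<open>p\<close>, the number
  \<open>fact n\<close> lies in the periodic range and is a multiple of the period. All such
  iterates agree modulo \<open>U\<close>, and adding \<open>fact N\<close> to the exponent changes
  nothing modulo \<open>U\<close>.\<close>

lemma eventually_constant_rcos_fact:
  assumes fg: "topologically_finitely_generated G T"
    and \<phi>: "continuous_endomorphism G T \<phi>"
    and U: "subgroup U G" "openin T U"
  shows "\<exists>N. \<forall>n\<ge>N. \<forall>x \<in> carrier G.
    U #> (\<phi> ^^ fact n) x = U #> (\<phi> ^^ fact N) x \<and>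
    U #> (\<phi> ^^ fact N) ((\<phi> ^^ fact n) x) = U #> (\<phi> ^^ fact n) x"
proof -
  obtain p a where p: "p > 0" and
    per: "\<forall>n\<ge>a. \<forall>x \<in> carrier G. U #> (\<phi> ^^ (n + p)) x = U #> (\<phi> ^^ n) x"
    using eventually_periodic_rcos[OF assms] by blast
  have mult: "U #> (\<phi> ^^ (n + k * p)) x = U #> (\<phi> ^^ n) x"
    if "n \<ge> a" "x \<in> carrier G" for n k x
  proof (induction k)
    case (Suc k)
    have "n + Suc k * p = (n + k * p) + p" by simp
    then show ?case
      using per[rule_format, of "n + k * p" x] that Suc by (simp add: add.assoc add.commute[of p])
  qed simp
  have per': "U #> (\<phi> ^^ m) x = U #> (\<phi> ^^ n) x"
    if "a \<le> n" "n \<le> m" "p dvd m - n" "x \<in> carrier G" for m n x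
  proof -
    obtain k where "m - n = p * k" using \<open>p dvd m - n\<close> by (rule dvdE)
    then have "m = n + k * p" using \<open>n \<le> m\<close> by (simp add: mult.commute)
    then show ?thesis using mult that by simp
  qed
  define N where "N = max a p"
  have dvd: "p dvd fact n" if "n \<ge> N" for n
    using that p by (intro dvd_fact) (auto simp: N_def)
  have ge: "fact n \<ge> a" if "n \<ge> N" for n
    using that fact_ge_self[of n] by (simp add: N_def)
  show ?thesis
  proof (intro exI conjI allI impI ballI)
    fix n x assume n: "n \<ge> N" and x: "x \<in> carrier G"
    show "U #> (\<phi> ^^ fact n) x = U #> (\<phi> ^^ fact N) x"
      using n x dvd[OF n] dvd[of N] ge[of N] by (intro per') (auto intro: fact_mono dvd_diff_nat)
    have "U #> (\<phi> ^^ (fact N + fact n)) x = U #> (\<phi> ^^ fact n) x"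
      using n x dvd[of N] ge[OF n] by (intro per') auto
    then show "U #> (\<phi> ^^ fact N) ((\<phi> ^^ fact n) x) = U #> (\<phi> ^^ fact n) x"
      by (simp add: funpow_add)
  qed
qed

section \<open>The limit of the factorial iterates\<close>

text \<open>Compactness yields a point \<open>r x\<close> with the eventual coset of the iterates
  for every open subgroup at once. The bound \<open>N U\<close> does not depend on \<open>x\<close>,
  so the convergence is uniform and the limit is continuous.\<close>

lemma idempotent_limit:
  assumes fg: "topologically_finitely_generated G T"
    and \<phi>: "continuous_endomorphism G T \<phi>"
  obtains r where "continuous_endomorphism G T r"
    "\<And>x. x \<in> carrier G \<Longrightarrow> limitin T (\<lambda>n. (\<phi> ^^ fact n) x) (r x) sequentially"
    "\<And>x. x \<in> carrier G \<Longrightarrow> r (r x) = r x"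
proof -
  define \<psi> where "\<psi> n = \<phi> ^^ fact n" for n
  have cont: "continuous_map T T (\<psi> n)" and hom: "\<psi> n \<in> hom G G" for n
    using continuous_endomorphism_funpow[OF \<phi>] by (auto simp: continuous_endomorphism_def \<psi>_def)
  have clos: "\<psi> n x \<in> carrier G" if "x \<in> carrier G" for n x
    using hom that by (meson hom_in_carrier)
  define OS where "OS = {U. subgroup U G \<and> openin T U}"
  have "\<forall>U \<in> OS. \<exists>N. \<forall>n\<ge>N. \<forall>x \<in> carrier G.
      U #> \<psi> n x = U #> \<psi> N x \<and> U #> \<psi> N (\<psi> n x) = U #> \<psi> n x"
    unfolding \<psi>_def OS_def using eventually_constant_rcos_fact[OF assms] by blast
  from bchoice[OF this] obtain N where N: "\<And>U n x. \<lbrakk>U \<in> OS; n \<ge> N U; x \<in> carrier G\<rbrakk> \<Longrightarrow>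
      U #> \<psi> n x = U #> \<psi> (N U) x \<and> U #> \<psi> (N U) (\<psi> n x) = U #> \<psi> n x"
    by blast
  have "\<exists>y \<in> carrier G. \<forall>U \<in> OS. U #> \<psi> (N U) x = U #> y" if x: "x \<in> carrier G" for x
  proof -
    \<comment> \<open>These closed cosets have the finite intersection property: a single late
      iterate of \<open>x\<close> lies in any finitely many of them.\<close>
    define \<C> where "\<C> = (\<lambda>U. U #> \<psi> (N U) x) ` OS"
    have "\<Inter>\<C> \<noteq> {}"
      using compact unfolding compact_space_fip
    proof (elim allE impE)
      show "Ball \<C> (closedin T) \<and> (\<forall>\<F>. finite \<F> \<and> \<F> \<subseteq> \<C> \<longrightarrow> \<Inter>\<F> \<noteq> {})"
      proof (intro conjI allI impI ballI)
        fix C assume "C \<in> \<C>"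
        then show "closedin T C"
          using closedin_r_coset closedin_open_subgroup clos[OF x] by (auto simp: \<C>_def OS_def)
      next
        fix \<F> assume "finite \<F> \<and> \<F> \<subseteq> \<C>"
        then obtain \<U> where \<U>: "\<U> \<subseteq> OS" "finite \<U>" "\<F> = (\<lambda>U. U #> \<psi> (N U) x) ` \<U>"
          unfolding \<C>_def by (meson finite_subset_image)
        \<comment> \<open>The extra \<open>0\<close> keeps the maximum defined for an empty
          subfamily.\<close>
        define m where "m = Max (insert 0 (N ` \<U>))"
        have "\<psi> m x \<in> U #> \<psi> (N U) x" if "U \<in> \<U>" for U
        proof -
          have "m \<ge> N U" using that \<U>(2) by (simp add: m_def)
          then have "U #> \<psi> m x = U #> \<psi> (N U) x" using N that \<U>(1) x by blast
          moreover have "subgroup U G" using that \<U>(1) by (auto simp: OS_def)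
          ultimately show ?thesis using rcos_self clos[OF x] by blast
        qed
        then show "\<Inter>\<F> \<noteq> {}" using \<U>(3) by blast
      qed
    qed
    then obtain y where y: "\<And>U. U \<in> OS \<Longrightarrow> y \<in> U #> \<psi> (N U) x" by (auto simp: \<C>_def)
    \<comment> \<open>The whole group is one of the open subgroups, which places \<open>y\<close>
      inside \<open>carrier G\<close>.\<close>
    have "carrier G \<in> OS"
      using subgroup_self openin_topspace[of T] by (simp add: OS_def topspace_eq_carrier)
    then have "y \<in> carrier G"
      using y r_coset_subset_G[OF subset_refl clos[OF x]] by blast
    moreover have "U #> \<psi> (N U) x = U #> y" if "U \<in> OS" for U
      using y[OF that] that clos[OF x] repr_independence by (auto simp: OS_def)
    ultimately show ?thesis by blast
  qed
  then obtain r where r: "\<And>x. x \<in> carrier G \<Longrightarrow> r x \<in> carrier G"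
    and rN: "\<And>U x. \<lbrakk>x \<in> carrier G; U \<in> OS\<rbrakk> \<Longrightarrow> U #> \<psi> (N U) x = U #> r x"
    by metis
  have rn: "U #> \<psi> n x = U #> r x" if "U \<in> OS" "x \<in> carrier G" "n \<ge> N U" for U x n
    using that N rN by metis
  have lim: "limitin T (\<lambda>n. \<psi> n x) (r x) sequentially" if x: "x \<in> carrier G" for x
    unfolding limitin_iff_rcos[OF r[OF x] clos[OF x]] eventually_sequentially
    using rn[OF _ x] unfolding OS_def by blast
  have "r (x \<otimes> y) = r x \<otimes> r y" if "x \<in> carrier G" "y \<in> carrier G" for x y
  proof -
    have "limitin T (\<lambda>n. \<psi> n (x \<otimes> y)) (r x \<otimes> r y) sequentially"
      using limitin_mult[OF lim lim] that hom_mult[OF hom] by simp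
    then show ?thesis
      using lim that limitin_Hausdorff_unique Hausdorff trivial_limit_sequentially m_closed by metis
  qed
  then have "r \<in> hom G G"
    using r by (auto simp: hom_def)
  moreover have "continuous_map T T r"
    unfolding continuous_map_def topspace_eq_carrier
  proof (intro conjI allI impI)
    show "r \<in> carrier G \<rightarrow> carrier G" using r by blast
    fix W assume W: "openin T W"
    show "openin T {x \<in> carrier G. r x \<in> W}"
    proof (subst openin_subopen, intro ballI)
      fix x assume x: "x \<in> {x \<in> carrier G. r x \<in> W}"
      then obtain U where U: "subgroup U G" "openin T U" "U #> r x \<subseteq> W"
        using exists_open_subgroup_coset[OF W] by blast
      then have OS: "U \<in> OS" by (simp add: OS_def)
      \<comment> \<open>Modulo \<open>U\<close> the map \<open>r\<close> equals the single
        continuous map \<open>\<psi> (N U)\<close> everywhere, so \<open>V\<close> is an open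
        neighbourhood on which \<open>r\<close> stays in one coset.\<close>
      define V where "V = {y \<in> carrier G. U #> \<psi> (N U) y = U #> r x}"
      have "openin T V"
        unfolding V_def using openin_rcos_eq[OF U(1,2) cont] r x by blast
      moreover have "x \<in> V" using x rN[OF _ OS] by (simp add: V_def)
      moreover have "V \<subseteq> {x \<in> carrier G. r x \<in> W}"
      proof
        fix y assume "y \<in> V"
        then have y: "y \<in> carrier G" "U #> r y = U #> r x"
          using rN[OF _ OS] by (auto simp: V_def)
        then have "r y \<in> W" using U rcos_self[OF r[OF y(1)] U(1)] by auto
        then show "y \<in> {x \<in> carrier G. r x \<in> W}" using y by blast
      qed
      ultimately show "\<exists>V. openin T V \<and> x \<in> V \<and> V \<subseteq> {x \<in> carrier G. r x \<in> W}" by blast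
    qed
  qed
  ultimately have endo: "continuous_endomorphism G T r"
    by (simp add: continuous_endomorphism_def)
  have idem: "r (r x) = r x" if x: "x \<in> carrier G" for x
  proof -
    \<comment> \<open>Modulo \<open>U\<close>, \<open>r (r x)\<close> is
      \<open>\<psi> (N U) (r x)\<close>, the limit of \<open>\<psi> (N U) (\<psi> n x)\<close>,
      which for large \<open>n\<close> has the coset of \<open>\<psi> n x\<close>. Uniqueness of
      limits then gives idempotence.\<close>
    have "limitin T (\<lambda>n. \<psi> n x) (r (r x)) sequentially"
      unfolding limitin_iff_rcos[OF r[OF r[OF x]] clos[OF x]]
    proof (intro allI impI)
      fix U assume U: "subgroup U G \<and> openin T U"
      then have OS: "U \<in> OS" by (simp add: OS_def)
      have "limitin T (\<lambda>n. \<psi> (N U) (\<psi> n x)) (\<psi> (N U) (r x)) sequentially"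
        using continuous_map_limit[OF cont lim[OF x]] by (simp add: o_def)
      then have "\<forall>\<^sub>F n in sequentially. U #> \<psi> (N U) (\<psi> n x) = U #> \<psi> (N U) (r x)"
        using limitin_iff_rcos[of _ "\<lambda>n. \<psi> (N U) (\<psi> n x)", OF clos[OF r[OF x]] clos[OF clos[OF x]]] U
        by blast
      then show "\<forall>\<^sub>F n in sequentially. U #> \<psi> n x = U #> r (r x)"
        using eventually_ge_at_top[of "N U"]
      proof eventually_elim
        case (elim n)
        have "U #> \<psi> n x = U #> \<psi> (N U) (\<psi> n x)"
          using N[OF OS elim(2) x] by blast
        also have "\<dots> = U #> r (r x)"
          using elim(1) rN[OF r[OF x] OS] by (rule trans)
        finally show ?case .
      qed
    qed
    then show ?thesis
      using lim[OF x] limitin_Hausdorff_unique Hausdorff trivial_limit_sequentially by metis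
  qed
  show thesis
    using that[OF endo] lim idem by (simp add: \<psi>_def)
qed

section \<open>Retracts and test elements\<close>

lemma retract_of_group_image:
  assumes "continuous_endomorphism G T r" "\<And>x. x \<in> carrier G \<Longrightarrow> r (r x) = r x"
  shows "retract_of_group (r ` carrier G) G T"
proof -
  have r: "r \<in> hom G G" "continuous_map T T r"
    using assms(1) by (auto simp: continuous_endomorphism_def)
  interpret r: group_hom G G r
    using r(1) by unfold_locales
  have "compactin T (r ` carrier G)"
    using image_compactin r(2) compact by (metis compact_space_def topspace_eq_carrier)
  then have "closedin T (r ` carrier G)"
    using Hausdorff compactin_imp_closedin by blast
  moreover have "subgroup (r ` carrier G) G"
    using r.img_is_subgroup .
  moreover have "r \<in> epi G (G\<lparr>carrier := r ` carrier G\<rparr>)"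
    using r(1) by (auto simp: epi_def hom_def)
  moreover have "continuous_map T (subtopology T (r ` carrier G)) r"
    using r(2) by (auto simp: continuous_map_in_subtopology topspace_eq_carrier)
  ultimately show ?thesis
    using assms(2) by (auto simp: retract_of_group_def closed_subgroup_def)
qed

text \<open>Every \<open>fact n\<close> is positive, so one \<open>\<phi>\<close> can be split off
  each iterate. Split off on the inside, it gives injectivity: points with equal images have equal
  limits. On the outside, it puts the iterates, hence their limit, in the closed image of
  \<open>\<phi>\<close>. Compactness then makes \<open>\<phi>\<close> a homeomorphism.\<close>

lemma continuous_automorphism_of_limit_id:
  assumes \<phi>: "continuous_endomorphism G T \<phi>"
    and lim: "\<And>x. x \<in> carrier G \<Longrightarrow> limitin T (\<lambda>n. (\<phi> ^^ fact n) x) x sequentially"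
  shows "continuous_automorphism G T \<phi>"
proof -
  have hom: "\<phi> \<in> hom G G" and cont: "continuous_map T T \<phi>"
    using \<phi> by (auto simp: continuous_endomorphism_def)
  have step: "fact n = Suc (fact n - 1)" for n
    by simp
  have inj: "inj_on \<phi> (carrier G)"
  proof (rule inj_onI)
    fix x y assume xy: "x \<in> carrier G" "y \<in> carrier G" "\<phi> x = \<phi> y"
    have "(\<phi> ^^ fact n) x = (\<phi> ^^ fact n) y" for n
      using xy(3) by (subst (1 2) step) (simp only: funpow_Suc_right comp_apply)
    then show "x = y"
      using lim[OF xy(1)] lim[OF xy(2)] limitin_Hausdorff_unique[OF _ _ _ Hausdorff]
      by (metis (no_types, lifting) ext trivial_limit_sequentially)
  qed
  have sub: "\<phi> ` carrier G \<subseteq> carrier G"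
    using hom by (auto simp: hom_def)
  have clos: "(\<phi> ^^ n) x \<in> carrier G" if "x \<in> carrier G" for n x
    using continuous_endomorphism_funpow[OF \<phi>, of n] that
    by (auto simp: continuous_endomorphism_def hom_def)
  have "closedin T (\<phi> ` carrier G)"
    using image_compactin cont compact compactin_imp_closedin[OF Hausdorff]
    by (metis compact_space_def topspace_eq_carrier)
  moreover have "(\<phi> ^^ fact n) x \<in> \<phi> ` carrier G" if "x \<in> carrier G" for n x
    by (subst step) (simp only: funpow.simps comp_apply imageI clos[OF that])
  ultimately have "x \<in> \<phi> ` carrier G" if "x \<in> carrier G" for x
    using limitin_closedin[OF lim[OF that]] that by simp
  with sub have surj: "\<phi> ` carrier G = carrier G" by blast
  have "homeomorphic_map T T \<phi>"
    using continuous_imp_homeomorphic_map[OF cont compact Hausdorff] surj inj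
    by (simp add: topspace_eq_carrier)
  moreover have "\<phi> \<in> iso G G"
    using hom inj surj by (auto simp: iso_def bij_betw_def)
  ultimately show ?thesis
    by (simp add: continuous_automorphism_def)
qed

lemma test_element_not_in_proper_retract:
  assumes "test_element G T g" "proper_retract_of_group H G T"
  shows "g \<notin> H"
proof
  assume g: "g \<in> H"
  obtain r where r: "r \<in> epi G (G\<lparr>carrier := H\<rparr>)" "continuous_map T (subtopology T H) r"
      "\<forall>h \<in> H. r h = h" and H: "subgroup H G" "H \<noteq> carrier G"
    using assms(2)
    by (auto simp: proper_retract_of_group_def retract_of_group_def closed_subgroup_def)
  have "r \<in> hom G G"
    using r(1) subgroup.subset[OF H(1)] by (auto simp: epi_def hom_def)
  moreover have "continuous_map T T r"
    using r(2) continuous_map_in_subtopology by blast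
  ultimately have "continuous_automorphism G T r"
    using assms(1) g r(3) by (auto simp: test_element_def continuous_endomorphism_def)
  then have "r ` carrier G = carrier G"
    by (auto simp: continuous_automorphism_def iso_def bij_betw_def)
  moreover have "r ` carrier G = H"
    using r(1) by (simp add: epi_def)
  ultimately show False
    using H(2) by simp
qed

lemma test_element_if_not_in_proper_retract:
  assumes fg: "topologically_finitely_generated G T" and g: "g \<in> carrier G"
    and retr: "\<And>H. proper_retract_of_group H G T \<Longrightarrow> g \<notin> H"
  shows "test_element G T g"
  unfolding test_element_def
proof (intro conjI allI impI g)
  fix \<phi> assume \<phi>: "continuous_endomorphism G T \<phi> \<and> \<phi> g = g"
  then obtain r where r: "continuous_endomorphism G T r"
    and lim: "\<And>x. x \<in> carrier G \<Longrightarrow> limitin T (\<lambda>n. (\<phi> ^^ fact n) x) (r x) sequentially"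
    and idem: "\<And>x. x \<in> carrier G \<Longrightarrow> r (r x) = r x"
    using idempotent_limit[OF fg] by blast
  have fix_g: "(\<phi> ^^ n) g = g" for n
    using \<phi> by (induction n) auto
  have "limitin T (\<lambda>n. g) (r g) sequentially"
    using lim[OF g] by (simp only: fix_g)
  moreover have "limitin T (\<lambda>n. g) g sequentially"
    using g by (simp add: Abstract_Limits.limitin_const_iff topspace_eq_carrier)
  ultimately have "r g = g"
    using limitin_Hausdorff_unique Hausdorff trivial_limit_sequentially by metis
  then have "g \<in> r ` carrier G"
    using g by (metis imageI)
  then have "r ` carrier G = carrier G"
    using retr retract_of_group_image[OF r idem] unfolding proper_retract_of_group_def by blast
  \<comment> \<open>Each \<open>x\<close> is now of the form \<open>r y\<close>, and idempotence
    fixes it.\<close>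
  then have "r x = x" if "x \<in> carrier G" for x
    using that idem by force
  then show "continuous_automorphism G T \<phi>"
    using continuous_automorphism_of_limit_id lim \<phi> by simp
qed

end

theorem theorem3p5:
  fixes G :: "('a, 'b) monoid_scheme" and T :: "'a topology" and g :: 'a
  assumes "profinite_group G T"
    and "topologically_finitely_generated G T"
    and "g \<in> carrier G"
  shows "test_element G T g \<longleftrightarrow> \<not> (\<exists>H. proper_retract_of_group H G T \<and> g \<in> H)"
  using profinite_group.test_element_not_in_proper_retract[OF assms(1)]
    profinite_group.test_element_if_not_in_proper_retract[OF assms]
  by blast

end
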